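(* Let $(\Omega,\Sigma,\mu)$ be a $\sigma$-finite measure space and $1\le p\le\infty$. Let $L_p^+(\mu)$ be the natural positive cone of $L_p(\mu)$ (functions that are $\ge 0$ a.e.). Then (i) $(L_p^+(\mu))_N\neq\emptyset$; (ii) for each $u\in(L_p^+(\mu))_N$, the generating space $(X_u,\|\cdot\|_u)$ is linearly isometric to $L_\infty(\mu)$.
   Context: Real scalars. For a closed convex set $C$ in a Banach space $X$, $C_N$ denotes the set of points $x\in C$ that are not support points, where $x\in C$ is a support point if there is a nonzero $x^*\in X^*$ with $\langle x^*,x\rangle=\max\{\langle x^*,y\rangle:y\in C\}$. With $X=L_p(\mu)$ and $C=L_p^+(\mu)$ (order a.e.), for $u\in C_N$ let $[-u,u]=\{f\in X:-u\le f\le u\}$, $X_u=C_u\cap(-C_u)$ with $C_u=\bigcup_{\lambda>0}\lambda(C-u)$ (equivalently $X_u=\bigcup_{\lambda>0}\lambda[-u,u]$), and $\|f\|_u=\inf\{\lambda>0:f\in\lambda[-u,u]\}$. *)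

theory Defs
  imports "HOL-Analysis.Analysis" "HOL-Probability.Essential_Supremum"
begin

section \<open>Real normed spaces on carrier sets\<close>

text \<open>
  The space \<open>L\<^sub>p(\<mu>)\<close> depends on the values \<open>p\<close> and \<open>\<mu>\<close>, so it cannot be a type of class
  \<^class>\<open>real_normed_vector\<close>; normed spaces are therefore given by an explicit carrier.
\<close>

record 'v nspace =
  vcarrier :: "'v set"
  vadd :: "'v \<Rightarrow> 'v \<Rightarrow> 'v"
  vscale :: "real \<Rightarrow> 'v \<Rightarrow> 'v"
  vnorm :: "'v \<Rightarrow> real"

definition linear_on :: "('v, 'a) nspace_scheme \<Rightarrow> ('v \<Rightarrow> 'w) \<Rightarrow> ('w, 'b) nspace_scheme \<Rightarrow> bool" where
  "linear_on V T W \<longleftrightarrow>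
     (\<forall>x\<in>vcarrier V. T x \<in> vcarrier W) \<and>
     (\<forall>x\<in>vcarrier V. \<forall>y\<in>vcarrier V. T (vadd V x y) = vadd W (T x) (T y)) \<and>
     (\<forall>c. \<forall>x\<in>vcarrier V. T (vscale V c x) = vscale W c (T x))"

definition real_nspace :: "real nspace" where
  "real_nspace = \<lparr>vcarrier = UNIV, vadd = (+), vscale = (*), vnorm = abs\<rparr>"

definition dual :: "'v nspace \<Rightarrow> ('v \<Rightarrow> real) set" where
  "dual V = {\<phi>. linear_on V \<phi> real_nspace \<and>
                (\<exists>K. \<forall>x\<in>vcarrier V. \<bar>\<phi> x\<bar> \<le> K * vnorm V x)}"

definition support_point :: "'v nspace \<Rightarrow> 'v set \<Rightarrow> 'v \<Rightarrow> bool" where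
  "support_point V C x \<longleftrightarrow> x \<in> C \<and>
     (\<exists>\<phi>\<in>dual V. (\<exists>z\<in>vcarrier V. \<phi> z \<noteq> 0) \<and> (\<forall>y\<in>C. \<phi> y \<le> \<phi> x))"

definition nonsupport_points :: "'v nspace \<Rightarrow> 'v set \<Rightarrow> 'v set" where
  "nonsupport_points V C = {x \<in> C. \<not> support_point V C x}"

text \<open>\<open>C\<^sub>u = \<Union>\<^bsub>\<lambda>>0\<^esub> \<lambda>(C - u)\<close> and \<open>X\<^sub>u = C\<^sub>u \<inter> (-C\<^sub>u)\<close>\<close>

definition cone_at :: "'v nspace \<Rightarrow> 'v set \<Rightarrow> 'v \<Rightarrow> 'v set" where
  "cone_at V C u = {vscale V t (vadd V c (vscale V (-1) u)) | t c. t > 0 \<and> c \<in> C}"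

definition generating_carrier :: "'v nspace \<Rightarrow> 'v set \<Rightarrow> 'v \<Rightarrow> 'v set" where
  "generating_carrier V C u = cone_at V C u \<inter> vscale V (-1) ` cone_at V C u"

definition linearly_isometric :: "'v nspace \<Rightarrow> 'w nspace \<Rightarrow> bool" where
  "linearly_isometric V W \<longleftrightarrow>
     (\<exists>T. linear_on V T W \<and> bij_betw T (vcarrier V) (vcarrier W) \<and>
          (\<forall>x\<in>vcarrier V. vnorm W (T x) = vnorm V x))"


section \<open>The spaces \<open>L\<^sub>p(\<mu>)\<close>\<close>

definition Lp_fun :: "ennreal \<Rightarrow> 'a measure \<Rightarrow> ('a \<Rightarrow> real) set" where
  "Lp_fun p M = {f \<in> borel_measurable M.
     (if p = \<infinity> then esssup M (\<lambda>x. ennreal \<bar>f x\<bar>) < \<infinity>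
      else (\<integral>\<^sup>+x. ennreal (\<bar>f x\<bar> powr enn2real p) \<partial>M) < \<infinity>)}"

definition Lp_fun_norm :: "ennreal \<Rightarrow> 'a measure \<Rightarrow> ('a \<Rightarrow> real) \<Rightarrow> real" where
  "Lp_fun_norm p M f =
     (if p = \<infinity> then enn2real (esssup M (\<lambda>x. ennreal \<bar>f x\<bar>))
      else enn2real (\<integral>\<^sup>+x. ennreal (\<bar>f x\<bar> powr enn2real p) \<partial>M) powr (1 / enn2real p))"

definition Lp_rel :: "ennreal \<Rightarrow> 'a measure \<Rightarrow> (('a \<Rightarrow> real) \<times> ('a \<Rightarrow> real)) set" where
  "Lp_rel p M = {(f, g). f \<in> Lp_fun p M \<and> g \<in> Lp_fun p M \<and> (AE x in M. f x = g x)}"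

text \<open>
  Elements of \<open>L\<^sub>p(\<mu>)\<close> are classes of a.e. equal functions. The unions below are over
  a single class, and similarly the norm is the common value on the class; see the lemmas
  \<open>vadd_Lp\<close>, \<open>vscale_Lp\<close> and \<open>vnorm_Lp\<close>.
\<close>

definition Lp :: "ennreal \<Rightarrow> 'a measure \<Rightarrow> ('a \<Rightarrow> real) set nspace" where
  "Lp p M =
     \<lparr>vcarrier = Lp_fun p M // Lp_rel p M,
      vadd = (\<lambda>A B. \<Union>f\<in>A. \<Union>g\<in>B. Lp_rel p M `` {\<lambda>x. f x + g x}),
      vscale = (\<lambda>c A. \<Union>f\<in>A. Lp_rel p M `` {\<lambda>x. c * f x}),
      vnorm = (\<lambda>A. the_elem (Lp_fun_norm p M ` A))\<rparr>"

definition Lp_le :: "'a measure \<Rightarrow> ('a \<Rightarrow> real) set \<Rightarrow> ('a \<Rightarrow> real) set \<Rightarrow> bool" where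
  "Lp_le M A B \<longleftrightarrow> (\<exists>f\<in>A. \<exists>g\<in>B. AE x in M. f x \<le> g x)"

definition Lp_cone :: "ennreal \<Rightarrow> 'a measure \<Rightarrow> ('a \<Rightarrow> real) set set" where
  "Lp_cone p M = {A \<in> vcarrier (Lp p M). \<exists>f\<in>A. AE x in M. 0 \<le> f x}"

definition Lp_interval :: "ennreal \<Rightarrow> 'a measure \<Rightarrow> ('a \<Rightarrow> real) set \<Rightarrow> ('a \<Rightarrow> real) set set" where
  "Lp_interval p M u =
     {A \<in> vcarrier (Lp p M). Lp_le M (vscale (Lp p M) (-1) u) A \<and> Lp_le M A u}"

definition Lp_gauge :: "ennreal \<Rightarrow> 'a measure \<Rightarrow> ('a \<Rightarrow> real) set \<Rightarrow> ('a \<Rightarrow> real) set \<Rightarrow> real" where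
  "Lp_gauge p M u A = Inf {t. t > 0 \<and> A \<in> vscale (Lp p M) t ` Lp_interval p M u}"

text \<open>The generating space \<open>(X\<^sub>u, \<parallel>\<cdot>\<parallel>\<^sub>u)\<close> for \<open>C = L\<^sub>p\<^sup>+(\<mu>)\<close>\<close>

definition Lp_generating :: "ennreal \<Rightarrow> 'a measure \<Rightarrow> ('a \<Rightarrow> real) set \<Rightarrow> ('a \<Rightarrow> real) set nspace" where
  "Lp_generating p M u =
     (Lp p M)\<lparr>vcarrier := generating_carrier (Lp p M) (Lp_cone p M) u,
              vnorm := Lp_gauge p M u\<rparr>"


section \<open>The operations on classes are well defined\<close>

lemma Lp_fun_measurable: "f \<in> Lp_fun p M \<Longrightarrow> f \<in> borel_measurable M"
  by (simp add: Lp_fun_def)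

lemma Lp_fun_add:
  assumes p: "1 \<le> p" and f: "f \<in> Lp_fun p M" and g: "g \<in> Lp_fun p M"
  shows "(\<lambda>x. f x + g x) \<in> Lp_fun p M"
proof (cases "p = \<infinity>")
  case True
  note [measurable] = f[THEN Lp_fun_measurable] g[THEN Lp_fun_measurable]
  let ?F = "esssup M (\<lambda>x. ennreal \<bar>f x\<bar>)" and ?G = "esssup M (\<lambda>x. ennreal \<bar>g x\<bar>)"
  have "AE x in M. ennreal \<bar>f x\<bar> \<le> ?F" "AE x in M. ennreal \<bar>g x\<bar> \<le> ?G"
    by (rule esssup_AE)+
  then have "AE x in M. ennreal \<bar>f x + g x\<bar> \<le> ?F + ?G"
  proof eventually_elim
    case (elim x)
    have "ennreal \<bar>f x + g x\<bar> \<le> ennreal (\<bar>f x\<bar> + \<bar>g x\<bar>)"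
      by (intro ennreal_leI) simp
    also have "\<dots> = ennreal \<bar>f x\<bar> + ennreal \<bar>g x\<bar>"
      by simp
    also have "\<dots> \<le> ?F + ?G"
      using elim by (intro add_mono)
    finally show ?case .
  qed
  then have "esssup M (\<lambda>x. ennreal \<bar>f x + g x\<bar>) \<le> ?F + ?G"
    by (intro esssup_I) auto
  also have "\<dots> < \<infinity>"
    using f g True by (simp add: Lp_fun_def)
  finally show ?thesis
    using True by (simp add: Lp_fun_def)
next
  case False
  note [measurable] = f[THEN Lp_fun_measurable] g[THEN Lp_fun_measurable]
  define r where "r = enn2real p"
  have r: "r \<ge> 0" by (simp add: r_def)
  have "(\<integral>\<^sup>+x. ennreal (\<bar>f x + g x\<bar> powr r) \<partial>M)
      \<le> (\<integral>\<^sup>+x. ennreal (2 powr r) * (ennreal (\<bar>f x\<bar> powr r) + ennreal (\<bar>g x\<bar> powr r)) \<partial>M)"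
  proof (rule nn_integral_mono)
    fix x
    have "\<bar>f x + g x\<bar> powr r \<le> (2 * max \<bar>f x\<bar> \<bar>g x\<bar>) powr r"
      using r by (intro powr_mono2) auto
    also have "\<dots> = 2 powr r * max \<bar>f x\<bar> \<bar>g x\<bar> powr r"
      by (simp add: powr_mult)
    also have "\<dots> \<le> 2 powr r * (\<bar>f x\<bar> powr r + \<bar>g x\<bar> powr r)"
      by (intro mult_left_mono) (auto simp: max_def)
    finally have "ennreal (\<bar>f x + g x\<bar> powr r)
        \<le> ennreal (2 powr r * (\<bar>f x\<bar> powr r + \<bar>g x\<bar> powr r))"
      by (rule ennreal_leI)
    then show "ennreal (\<bar>f x + g x\<bar> powr r)
        \<le> ennreal (2 powr r) * (ennreal (\<bar>f x\<bar> powr r) + ennreal (\<bar>g x\<bar> powr r))"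
      by (simp add: ennreal_mult)
  qed
  also have "\<dots> = ennreal (2 powr r) *
      ((\<integral>\<^sup>+x. ennreal (\<bar>f x\<bar> powr r) \<partial>M) + (\<integral>\<^sup>+x. ennreal (\<bar>g x\<bar> powr r) \<partial>M))"
    by (simp add: nn_integral_cmult nn_integral_add)
  also have "\<dots> < \<infinity>"
    using f g False by (auto simp: Lp_fun_def r_def ennreal_mult_less_top)
  finally show ?thesis
    using False by (simp add: Lp_fun_def r_def)
qed

lemma Lp_fun_scale:
  assumes f: "f \<in> Lp_fun p M"
  shows "(\<lambda>x. c * f x) \<in> Lp_fun p M"
proof (cases "p = \<infinity>")
  case True
  note [measurable] = f[THEN Lp_fun_measurable]
  let ?F = "esssup M (\<lambda>x. ennreal \<bar>f x\<bar>)"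
  have "AE x in M. ennreal \<bar>f x\<bar> \<le> ?F"
    by (rule esssup_AE)
  then have "AE x in M. ennreal \<bar>c * f x\<bar> \<le> ennreal \<bar>c\<bar> * ?F"
    by eventually_elim (auto simp: abs_mult ennreal_mult intro!: mult_left_mono)
  then have "esssup M (\<lambda>x. ennreal \<bar>c * f x\<bar>) \<le> ennreal \<bar>c\<bar> * ?F"
    by (intro esssup_I) auto
  also have "\<dots> < \<infinity>"
    using f True by (simp add: Lp_fun_def ennreal_mult_less_top)
  finally show ?thesis
    using True by (simp add: Lp_fun_def)
next
  case False
  note [measurable] = f[THEN Lp_fun_measurable]
  have "(\<integral>\<^sup>+x. ennreal (\<bar>c * f x\<bar> powr enn2real p) \<partial>M)
      = ennreal (\<bar>c\<bar> powr enn2real p) * (\<integral>\<^sup>+x. ennreal (\<bar>f x\<bar> powr enn2real p) \<partial>M)"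
    by (simp add: abs_mult powr_mult ennreal_mult nn_integral_cmult)
  also have "\<dots> < \<infinity>"
    using f False by (simp add: Lp_fun_def ennreal_mult_less_top)
  finally show ?thesis
    using False by (simp add: Lp_fun_def)
qed

lemma equiv_Lp_rel: "equiv (Lp_fun p M) (Lp_rel p M)"
  by (rule equivI) (auto simp: Lp_rel_def refl_on_def sym_def trans_def)

lemma Lp_class_eq:
  assumes "f \<in> Lp_fun p M" "g \<in> Lp_fun p M" "AE x in M. f x = g x"
  shows "Lp_rel p M `` {f} = Lp_rel p M `` {g}"
  using assms by (intro equiv_class_eq[OF equiv_Lp_rel]) (simp add: Lp_rel_def)

lemma Lp_fun_norm_cong:
  assumes "f \<in> Lp_fun p M" "g \<in> Lp_fun p M" "AE x in M. f x = g x"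
  shows "Lp_fun_norm p M f = Lp_fun_norm p M g"
proof -
  have "esssup M (\<lambda>x. ennreal \<bar>f x\<bar>) = esssup M (\<lambda>x. ennreal \<bar>g x\<bar>)"
    using assms(3) Lp_fun_measurable[OF assms(1)] Lp_fun_measurable[OF assms(2)]
    by (intro antisym esssup_AE_mono) (auto elim!: eventually_mono)
  moreover have "(\<integral>\<^sup>+x. ennreal (\<bar>f x\<bar> powr enn2real p) \<partial>M) = (\<integral>\<^sup>+x. ennreal (\<bar>g x\<bar> powr enn2real p) \<partial>M)"
    using assms(3) by (intro nn_integral_cong_AE) auto
  ultimately show ?thesis
    by (simp add: Lp_fun_norm_def)
qed

lemma vadd_Lp:
  assumes "1 \<le> p" and f: "f \<in> Lp_fun p M" and g: "g \<in> Lp_fun p M"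
  shows "vadd (Lp p M) (Lp_rel p M `` {f}) (Lp_rel p M `` {g}) = Lp_rel p M `` {\<lambda>x. f x + g x}"
proof -
  have "Lp_rel p M `` {\<lambda>x. f' x + g' x} = Lp_rel p M `` {\<lambda>x. f x + g x}"
    if "f' \<in> Lp_rel p M `` {f}" "g' \<in> Lp_rel p M `` {g}" for f' g'
    using that assms by (intro Lp_class_eq Lp_fun_add) (auto simp: Lp_rel_def)
  then have "vadd (Lp p M) (Lp_rel p M `` {f}) (Lp_rel p M `` {g}) =
      (\<Union>f'\<in>Lp_rel p M `` {f}. \<Union>g'\<in>Lp_rel p M `` {g}. Lp_rel p M `` {\<lambda>x. f x + g x})"
    unfolding Lp_def nspace.simps by (intro SUP_cong refl)
  moreover have "f \<in> Lp_rel p M `` {f}" "g \<in> Lp_rel p M `` {g}"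
    using f g by (auto simp: Lp_rel_def)
  then have "Lp_rel p M `` {f} \<noteq> {}" "Lp_rel p M `` {g} \<noteq> {}"
    by (metis empty_iff)+
  ultimately show ?thesis
    by (simp only: UN_constant if_False)
qed

lemma vscale_Lp:
  assumes f: "f \<in> Lp_fun p M"
  shows "vscale (Lp p M) c (Lp_rel p M `` {f}) = Lp_rel p M `` {\<lambda>x. c * f x}"
proof -
  have "Lp_rel p M `` {\<lambda>x. c * f' x} = Lp_rel p M `` {\<lambda>x. c * f x}"
    if "f' \<in> Lp_rel p M `` {f}" for f'
  proof (rule Lp_class_eq)
    have *: "f' \<in> Lp_fun p M" "AE x in M. f x = f' x"
      using that by (auto simp: Lp_rel_def)
    show "(\<lambda>x. c * f' x) \<in> Lp_fun p M" "(\<lambda>x. c * f x) \<in> Lp_fun p M"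
      using *(1) f by (auto intro: Lp_fun_scale)
    show "AE x in M. c * f' x = c * f x"
      using *(2) by eventually_elim simp
  qed
  then have "vscale (Lp p M) c (Lp_rel p M `` {f}) =
      (\<Union>f'\<in>Lp_rel p M `` {f}. Lp_rel p M `` {\<lambda>x. c * f x})"
    unfolding Lp_def nspace.simps by (intro SUP_cong refl)
  moreover have "f \<in> Lp_rel p M `` {f}"
    using f by (auto simp: Lp_rel_def)
  then have "Lp_rel p M `` {f} \<noteq> {}"
    by (metis empty_iff)
  ultimately show ?thesis
    by (simp only: UN_constant if_False)
qed

lemma vnorm_Lp:
  assumes f: "f \<in> Lp_fun p M"
  shows "vnorm (Lp p M) (Lp_rel p M `` {f}) = Lp_fun_norm p M f"
proof -
  have "Lp_fun_norm p M f' = Lp_fun_norm p M f" if "f' \<in> Lp_rel p M `` {f}" for f'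
    using that f by (intro Lp_fun_norm_cong) (auto simp: Lp_rel_def)
  moreover have "f \<in> Lp_rel p M `` {f}"
    using f by (auto simp: Lp_rel_def)
  ultimately have "Lp_fun_norm p M ` (Lp_rel p M `` {f}) = {Lp_fun_norm p M f}"
    by blast
  then show ?thesis
    by (simp add: Lp_def)
qed

end

theory Submission
  imports Defs
begin

text \<open>
  A point \<open>u\<close> of the cone is a nonsupport point only if \<open>u > 0\<close> a.e.: otherwise \<open>u\<close> vanishes on a
  set \<open>B\<close> of positive finite measure, and \<open>f \<mapsto> - \<integral>\<^sub>B f\<close> supports the cone at \<open>u\<close>.
  Then \<open>f \<mapsto> f / u\<close> is the required isometry, since \<open>\<bar>f\<bar> \<le> t u\<close> a.e. iff \<open>\<bar>f / u\<bar> \<le> t\<close> a.e.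
  For existence, a functional that attains its maximum over the cone at \<open>u\<close> is nonpositive on the
  cone and vanishes at \<open>u\<close>, hence vanishes on \<open>min f (n u)\<close> for all \<open>f \<ge> 0\<close>; so it is zero as soon as
  \<open>min f (n u) \<rightarrow> f\<close> in norm. This holds for \<open>u = 1\<close> if \<open>p = \<infinity>\<close>, and by dominated convergence for
  every \<open>u > 0\<close> if \<open>p < \<infinity>\<close>.
\<close>

section \<open>Functions and classes\<close>

abbreviation Lp_class :: "ennreal \<Rightarrow> 'a measure \<Rightarrow> ('a \<Rightarrow> real) \<Rightarrow> ('a \<Rightarrow> real) set" where
  "Lp_class p M f \<equiv> Lp_rel p M `` {f}"

text \<open>Both the essential supremum and the integral of a power are monotone. This gives
  membership of the truncations, of positive and negative parts, and of products
  \<open>g x * u x\<close> with bounded \<open>g\<close>.\<close>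

lemma Lp_fun_dominated:
  assumes f: "f \<in> Lp_fun p M" and g[measurable]: "g \<in> borel_measurable M"
    and le: "AE x in M. \<bar>g x\<bar> \<le> \<bar>f x\<bar>"
  shows "g \<in> Lp_fun p M"
proof (cases "p = \<infinity>")
  case True
  note [measurable] = f[THEN Lp_fun_measurable]
  have "esssup M (\<lambda>x. ennreal \<bar>g x\<bar>) \<le> esssup M (\<lambda>x. ennreal \<bar>f x\<bar>)"
    using le by (intro esssup_AE_mono) (auto elim!: eventually_mono intro: ennreal_leI)
  then show ?thesis
    using f True by (auto simp: Lp_fun_def intro: le_less_trans)
next
  case False
  have "(\<integral>\<^sup>+x. ennreal (\<bar>g x\<bar> powr enn2real p) \<partial>M) \<le> (\<integral>\<^sup>+x. ennreal (\<bar>f x\<bar> powr enn2real p) \<partial>M)"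
    using le by (intro nn_integral_mono_AE) (auto elim!: eventually_mono intro!: ennreal_leI powr_mono2)
  then show ?thesis
    using f False by (auto simp: Lp_fun_def intro: le_less_trans)
qed

text \<open>The essential supremum is itself an a.e. bound, and the least one. The sign condition on
  \<open>t\<close> matters because \<open>ennreal\<close> sends negative reals to 0.\<close>

lemma esssup_abs_le_iff:
  assumes [measurable]: "f \<in> borel_measurable M" and "0 \<le> t"
  shows "esssup M (\<lambda>x. ennreal \<bar>f x\<bar>) \<le> ennreal t \<longleftrightarrow> (AE x in M. \<bar>f x\<bar> \<le> t)"
proof
  assume *: "esssup M (\<lambda>x. ennreal \<bar>f x\<bar>) \<le> ennreal t"
  have "AE x in M. ennreal \<bar>f x\<bar> \<le> esssup M (\<lambda>x. ennreal \<bar>f x\<bar>)"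
    by (rule esssup_AE)
  then show "AE x in M. \<bar>f x\<bar> \<le> t"
    by eventually_elim (metis * \<open>0 \<le> t\<close> order.trans ennreal_le_iff)
next
  assume "AE x in M. \<bar>f x\<bar> \<le> t"
  then show "esssup M (\<lambda>x. ennreal \<bar>f x\<bar>) \<le> ennreal t"
    by (intro esssup_I) (auto elim!: eventually_mono intro: ennreal_leI)
qed

lemma Lp_fun_infinity_bounded:
  assumes [measurable]: "f \<in> borel_measurable M" and "AE x in M. \<bar>f x\<bar> \<le> t"
  shows "f \<in> Lp_fun \<infinity> M"
proof -
  \<comment> \<open>The given bound may be negative, so it is first replaced by its absolute
    value.\<close>
  have "AE x in M. \<bar>f x\<bar> \<le> \<bar>t\<bar>"
    using assms(2) by eventually_elim simp
  then have "esssup M (\<lambda>x. ennreal \<bar>f x\<bar>) \<le> ennreal \<bar>t\<bar>"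
    by (subst esssup_abs_le_iff) auto
  then show ?thesis
    by (auto simp: Lp_fun_def intro: le_less_trans)
qed

text \<open>Membership in \<open>Lp_fun \<infinity> M\<close> makes the essential supremum finite,
  so \<open>enn2real\<close> loses nothing; an infinite value would be sent to 0.\<close>

lemma Lp_fun_infinity_norm_le_iff:
  assumes f: "f \<in> Lp_fun \<infinity> M" and "0 \<le> t"
  shows "Lp_fun_norm \<infinity> M f \<le> t \<longleftrightarrow> (AE x in M. \<bar>f x\<bar> \<le> t)"
proof -
  have "esssup M (\<lambda>x. ennreal \<bar>f x\<bar>) < \<infinity>"
    using f by (simp add: Lp_fun_def)
  then have "Lp_fun_norm \<infinity> M f \<le> t \<longleftrightarrow> esssup M (\<lambda>x. ennreal \<bar>f x\<bar>) \<le> ennreal t"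
    using \<open>0 \<le> t\<close> by (cases "esssup M (\<lambda>x. ennreal \<bar>f x\<bar>)") (auto simp: Lp_fun_norm_def)
  then show ?thesis
    using esssup_abs_le_iff[OF Lp_fun_measurable[OF f] \<open>0 \<le> t\<close>] by simp
qed

lemma Lp_fun_norm_nonneg: "0 \<le> Lp_fun_norm p M f"
  by (simp add: Lp_fun_norm_def)

lemma Lp_fun_indicator:
  assumes B: "B \<in> sets M" "emeasure M B < \<infinity>"
  shows "(indicator B :: _ \<Rightarrow> real) \<in> Lp_fun p M"
proof (cases "p = \<infinity>")
  case True
  show ?thesis
    unfolding True using B by (intro Lp_fun_infinity_bounded[where t=1]) (auto simp: indicator_def)
next
  case False
  have "(\<integral>\<^sup>+x. ennreal (\<bar>indicator B x\<bar> powr enn2real p) \<partial>M) = (\<integral>\<^sup>+x. indicator B x \<partial>M)"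
    by (intro nn_integral_cong) (auto simp: indicator_def)
  then show ?thesis
    using B False by (simp add: Lp_fun_def)
qed

section \<open>Passing between classes and representatives\<close>

lemma Lp_carrier_iff: "A \<in> vcarrier (Lp p M) \<longleftrightarrow> (\<exists>f\<in>Lp_fun p M. A = Lp_class p M f)"
  by (auto simp: Lp_def quotient_def)

lemma mem_Lp_class: "g \<in> Lp_class p M f \<longleftrightarrow> f \<in> Lp_fun p M \<and> g \<in> Lp_fun p M \<and> (AE x in M. f x = g x)"
  by (simp add: Lp_rel_def)

text \<open>Maps on classes are defined below by choosing a representative; this ties the choice
  back to any known representative.\<close>

lemma some_Lp_class:
  assumes "f \<in> Lp_fun p M"
  shows "(SOME g. g \<in> Lp_class p M f) \<in> Lp_fun p M"
    and "AE x in M. f x = (SOME g. g \<in> Lp_class p M f) x"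
proof -
  have "f \<in> Lp_class p M f"
    using assms by (simp add: Lp_rel_def)
  then have "(SOME g. g \<in> Lp_class p M f) \<in> Lp_class p M f"
    by (rule someI[of "\<lambda>g. g \<in> Lp_class p M f"])
  then show "(SOME g. g \<in> Lp_class p M f) \<in> Lp_fun p M"
    and "AE x in M. f x = (SOME g. g \<in> Lp_class p M f) x"
    unfolding mem_Lp_class by blast+
qed

lemma Lp_class_eq_iff:
  assumes "f \<in> Lp_fun p M" "g \<in> Lp_fun p M"
  shows "Lp_class p M f = Lp_class p M g \<longleftrightarrow> (AE x in M. f x = g x)"
  using eq_equiv_class_iff[OF equiv_Lp_rel assms] assms by (simp add: Lp_rel_def)

lemma Lp_le_class_iff:
  assumes "f \<in> Lp_fun p M" "g \<in> Lp_fun p M"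
  shows "Lp_le M (Lp_class p M f) (Lp_class p M g) \<longleftrightarrow> (AE x in M. f x \<le> g x)"
proof
  assume "Lp_le M (Lp_class p M f) (Lp_class p M g)"
  then obtain f' g' where "AE x in M. f x = f' x" "AE x in M. g x = g' x" "AE x in M. f' x \<le> g' x"
    unfolding Lp_le_def mem_Lp_class Bex_def by blast
  then show "AE x in M. f x \<le> g x"
    by eventually_elim simp
next
  assume "AE x in M. f x \<le> g x"
  moreover have "f \<in> Lp_class p M f" "g \<in> Lp_class p M g"
    using assms by (simp_all add: Lp_rel_def)
  ultimately show "Lp_le M (Lp_class p M f) (Lp_class p M g)"
    unfolding Lp_le_def by blast
qed

lemma Lp_cone_class_iff:
  assumes "f \<in> Lp_fun p M"
  shows "Lp_class p M f \<in> Lp_cone p M \<longleftrightarrow> (AE x in M. 0 \<le> f x)"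
proof
  assume "Lp_class p M f \<in> Lp_cone p M"
  then obtain f' where "AE x in M. f x = f' x" "AE x in M. 0 \<le> f' x"
    unfolding Lp_cone_def mem_Collect_eq mem_Lp_class Bex_def by blast
  then show "AE x in M. 0 \<le> f x"
    by eventually_elim simp
next
  assume "AE x in M. 0 \<le> f x"
  moreover have "f \<in> Lp_class p M f"
    using assms by (simp add: Lp_rel_def)
  ultimately show "Lp_class p M f \<in> Lp_cone p M"
    using assms unfolding Lp_cone_def mem_Collect_eq Lp_carrier_iff by blast
qed

lemma Lp_cone_cases:
  assumes "A \<in> Lp_cone p M"
  obtains f where "f \<in> Lp_fun p M" "AE x in M. 0 \<le> f x" "A = Lp_class p M f"
proof -
  have "A \<in> vcarrier (Lp p M)"
    using assms by (simp add: Lp_cone_def)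
  then obtain f where f: "f \<in> Lp_fun p M" "A = Lp_class p M f"
    unfolding Lp_carrier_iff by blast
  with assms have "AE x in M. 0 \<le> f x"
    using Lp_cone_class_iff[OF f(1)] by blast
  with f show thesis
    using that by blast
qed

section \<open>The generating space\<close>

text \<open>Solving \<open>f = t * (c - u)\<close> for \<open>c\<close> gives
  \<open>c = f / t + u\<close>, which is nonnegative exactly when \<open>f\<close> is at least
  \<open>- (t * u)\<close>.\<close>

lemma cone_at_class_iff:
  assumes p: "1 \<le> p" and u: "u \<in> Lp_fun p M" and f: "f \<in> Lp_fun p M"
  shows "Lp_class p M f \<in> cone_at (Lp p M) (Lp_cone p M) (Lp_class p M u) \<longleftrightarrow>
    (\<exists>t>0. AE x in M. - (t * u x) \<le> f x)"
proof
  assume "Lp_class p M f \<in> cone_at (Lp p M) (Lp_cone p M) (Lp_class p M u)"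
  then obtain t C where t: "t > 0" and C: "C \<in> Lp_cone p M" and
    eq: "Lp_class p M f = vscale (Lp p M) t (vadd (Lp p M) C (vscale (Lp p M) (-1) (Lp_class p M u)))"
    unfolding cone_at_def by blast
  obtain c where c: "c \<in> Lp_fun p M" "AE x in M. 0 \<le> c x" "C = Lp_class p M c"
    using Lp_cone_cases[OF C] .
  have "Lp_class p M f = Lp_class p M (\<lambda>x. t * (c x + (-1) * u x))"
    unfolding eq c(3) using c(1) u p
    by (simp only: vscale_Lp vadd_Lp Lp_fun_scale Lp_fun_add)
  then have "AE x in M. f x = t * (c x + (-1) * u x)"
    using Lp_class_eq_iff[OF f Lp_fun_scale[OF Lp_fun_add[OF p c(1) Lp_fun_scale[OF u]]]] by blast
  with c(2) have "AE x in M. - (t * u x) \<le> f x"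
  proof eventually_elim
    case (elim x)
    then have "0 \<le> t * c x"
      using t by simp
    with elim show ?case
      by (simp add: algebra_simps)
  qed
  with t show "\<exists>t>0. AE x in M. - (t * u x) \<le> f x"
    by blast
next
  assume "\<exists>t>0. AE x in M. - (t * u x) \<le> f x"
  then obtain t where t: "t > 0" "AE x in M. - (t * u x) \<le> f x"
    by blast
  define c where "c = (\<lambda>x. (1/t) * f x + u x)"
  have c: "c \<in> Lp_fun p M"
    unfolding c_def by (intro Lp_fun_add Lp_fun_scale p f u)
  have "AE x in M. 0 \<le> c x"
    using t(2) by eventually_elim (use t(1) in \<open>simp add: c_def field_simps\<close>)
  then have "Lp_class p M c \<in> Lp_cone p M"
    using c by (simp add: Lp_cone_class_iff)
  moreover have "Lp_class p M f =
      vscale (Lp p M) t (vadd (Lp p M) (Lp_class p M c) (vscale (Lp p M) (-1) (Lp_class p M u)))"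
  proof -
    have "(\<lambda>x. t * (c x + (-1) * u x)) = f"
      using t(1) by (auto simp: c_def)
    then show ?thesis
      using c u p by (simp only: vscale_Lp vadd_Lp Lp_fun_scale Lp_fun_add)
  qed
  ultimately show "Lp_class p M f \<in> cone_at (Lp p M) (Lp_cone p M) (Lp_class p M u)"
    unfolding cone_at_def using t(1) by blast
qed

lemma cone_at_cases:
  assumes p: "1 \<le> p" and u: "u \<in> Lp_fun p M"
    and A: "A \<in> cone_at (Lp p M) (Lp_cone p M) (Lp_class p M u)"
  obtains f where "f \<in> Lp_fun p M" "A = Lp_class p M f"
proof -
  obtain t C where C: "C \<in> Lp_cone p M" and
    eq: "A = vscale (Lp p M) t (vadd (Lp p M) C (vscale (Lp p M) (-1) (Lp_class p M u)))"
    using A unfolding cone_at_def by blast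
  obtain c where c: "c \<in> Lp_fun p M" "C = Lp_class p M c"
    using Lp_cone_cases[OF C] by metis
  have "A = Lp_class p M (\<lambda>x. t * (c x + (-1) * u x))"
    unfolding eq c(2) using c(1) u p
    by (simp only: vscale_Lp vadd_Lp Lp_fun_scale Lp_fun_add)
  then show thesis
    using that[OF Lp_fun_scale[OF Lp_fun_add[OF p c(1) Lp_fun_scale[OF u]]]] by blast
qed

text \<open>The criterion for the cone, applied to \<open>f\<close> and to its negative, bounds
  \<open>f\<close> between \<open>- (s * u)\<close> and \<open>t * u\<close>. As \<open>u\<close> is
  nonnegative, \<open>s + t\<close> serves for both sides. This is the description of the generating
  space as the union of the multiples of the order interval.\<close>

lemma generating_carrier_iff:
  assumes p: "1 \<le> p" and u: "u \<in> Lp_fun p M" and u0: "AE x in M. 0 \<le> u x"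
  shows "A \<in> generating_carrier (Lp p M) (Lp_cone p M) (Lp_class p M u) \<longleftrightarrow>
    (\<exists>f\<in>Lp_fun p M. A = Lp_class p M f \<and> (\<exists>t>0. AE x in M. \<bar>f x\<bar> \<le> t * u x))"
    (is "?L \<longleftrightarrow> ?R")
proof
  assume ?L
  then obtain B where A: "A \<in> cone_at (Lp p M) (Lp_cone p M) (Lp_class p M u)"
    and B: "B \<in> cone_at (Lp p M) (Lp_cone p M) (Lp_class p M u)" and AB: "A = vscale (Lp p M) (-1) B"
    unfolding generating_carrier_def by blast
  obtain g where g: "g \<in> Lp_fun p M" "B = Lp_class p M g"
    using cone_at_cases[OF p u B] .
  have f: "(\<lambda>x. -1 * g x) \<in> Lp_fun p M"
    using g(1) by (rule Lp_fun_scale)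
  have Af: "A = Lp_class p M (\<lambda>x. -1 * g x)"
    unfolding AB g(2) by (rule vscale_Lp[OF g(1)])
  obtain s t where st: "s > 0" "t > 0" "AE x in M. - (s * u x) \<le> g x" "AE x in M. - (t * u x) \<le> -1 * g x"
    using cone_at_class_iff[OF p u g(1)] B cone_at_class_iff[OF p u f] A unfolding Af g(2) by blast
  from st(3,4) u0 have "AE x in M. \<bar>-1 * g x\<bar> \<le> (s + t) * u x"
  proof eventually_elim
    case (elim x)
    have "0 \<le> s * u x" "0 \<le> t * u x"
      using elim st(1,2) by auto
    then show ?case
      unfolding distrib_right using elim by linarith
  qed
  with st(1,2) have "\<exists>t>0. AE x in M. \<bar>-1 * g x\<bar> \<le> t * u x"
    by (intro exI[of _ "s + t"]) auto
  with f Af show ?R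
    by blast
next
  assume ?R
  then obtain f t where f: "f \<in> Lp_fun p M" "A = Lp_class p M f" and t: "t > 0" "AE x in M. \<bar>f x\<bar> \<le> t * u x"
    by blast
  have g: "(\<lambda>x. -1 * f x) \<in> Lp_fun p M"
    using f(1) by (rule Lp_fun_scale)
  have "AE x in M. - (t * u x) \<le> f x" "AE x in M. - (t * u x) \<le> -1 * f x"
    using t(2) by (eventually_elim, linarith)+
  then have "A \<in> cone_at (Lp p M) (Lp_cone p M) (Lp_class p M u)"
    "Lp_class p M (\<lambda>x. -1 * f x) \<in> cone_at (Lp p M) (Lp_cone p M) (Lp_class p M u)"
    using cone_at_class_iff[OF p u f(1)] cone_at_class_iff[OF p u g] t(1) f(2) by blast+
  moreover have "A = vscale (Lp p M) (-1) (Lp_class p M (\<lambda>x. -1 * f x))"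
    unfolding vscale_Lp[OF g] f(2) by simp
  ultimately show ?L
    unfolding generating_carrier_def by blast
qed

section \<open>The gauge as a norm in the space of bounded functions\<close>

text \<open>Identifies the numbers \<open>t\<close> that compete in the infimum defining the gauge;
  the element of the interval to be scaled is \<open>f / t\<close>.\<close>

lemma scaled_interval_iff:
  assumes u: "u \<in> Lp_fun p M" and f: "f \<in> Lp_fun p M" and t: "t > 0"
  shows "Lp_class p M f \<in> vscale (Lp p M) t ` Lp_interval p M (Lp_class p M u) \<longleftrightarrow>
    (AE x in M. \<bar>f x\<bar> \<le> t * u x)"
proof
  have u': "(\<lambda>x. -1 * u x) \<in> Lp_fun p M"
    using u by (rule Lp_fun_scale)
  have int: "Lp_class p M g \<in> Lp_interval p M (Lp_class p M u) \<longleftrightarrow>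
    (AE x in M. -1 * u x \<le> g x) \<and> (AE x in M. g x \<le> u x)" if g: "g \<in> Lp_fun p M" for g
    using g unfolding Lp_interval_def mem_Collect_eq vscale_Lp[OF u] Lp_le_class_iff[OF u' g]
      Lp_le_class_iff[OF g u] Lp_carrier_iff by blast
  {
    assume "Lp_class p M f \<in> vscale (Lp p M) t ` Lp_interval p M (Lp_class p M u)"
    then obtain g where g: "g \<in> Lp_fun p M" "Lp_class p M g \<in> Lp_interval p M (Lp_class p M u)"
      and eq: "Lp_class p M f = vscale (Lp p M) t (Lp_class p M g)"
      unfolding Lp_interval_def mem_Collect_eq image_iff Bex_def Lp_carrier_iff by blast
    have "AE x in M. f x = t * g x"
      using eq unfolding vscale_Lp[OF g(1)] by (simp add: Lp_class_eq_iff f g(1) Lp_fun_scale)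
    moreover have "AE x in M. -1 * u x \<le> g x" "AE x in M. g x \<le> u x"
      using g int by auto
    ultimately show "AE x in M. \<bar>f x\<bar> \<le> t * u x"
      by eventually_elim (use t in \<open>simp add: abs_mult\<close>)
  }
  {
    assume le: "AE x in M. \<bar>f x\<bar> \<le> t * u x"
    have g: "(\<lambda>x. (1/t) * f x) \<in> Lp_fun p M"
      using f by (rule Lp_fun_scale)
    have "AE x in M. -1 * u x \<le> (1/t) * f x" "AE x in M. (1/t) * f x \<le> u x"
      using le by (eventually_elim, use t in \<open>simp add: field_simps\<close>)+
    then have "Lp_class p M (\<lambda>x. (1/t) * f x) \<in> Lp_interval p M (Lp_class p M u)"
      using int[OF g] by blast
    moreover have "Lp_class p M f = vscale (Lp p M) t (Lp_class p M (\<lambda>x. (1/t) * f x))"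
      unfolding vscale_Lp[OF g] using t by simp
    ultimately show "Lp_class p M f \<in> vscale (Lp p M) t ` Lp_interval p M (Lp_class p M u)"
      by blast
  }
qed

lemma abs_le_mult_iff_quotient:
  fixes u f :: "'a \<Rightarrow> real"
  assumes "AE x in M. 0 < u x"
  shows "(AE x in M. \<bar>f x\<bar> \<le> t * u x) \<longleftrightarrow> (AE x in M. \<bar>f x / u x\<bar> \<le> t)"
  by (rule eventually_subst, use assms in eventually_elim) (simp add: field_simps)

text \<open>A number \<open>t > 0\<close> competes in the infimum iff \<open>f / u\<close> is a.e.
  bounded by \<open>t\<close>, that is, iff its essential sup norm is at most
  \<open>t\<close>.\<close>

lemma Lp_gauge_eq:
  assumes u: "u \<in> Lp_fun p M" and pos: "AE x in M. 0 < u x" and f: "f \<in> Lp_fun p M"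
    and q: "(\<lambda>x. f x / u x) \<in> Lp_fun \<infinity> M"
  shows "Lp_gauge p M (Lp_class p M u) (Lp_class p M f) = Lp_fun_norm \<infinity> M (\<lambda>x. f x / u x)"
proof -
  define s where "s = Lp_fun_norm \<infinity> M (\<lambda>x. f x / u x)"
  have s: "0 \<le> s"
    unfolding s_def by (rule Lp_fun_norm_nonneg)
  have "t > 0 \<and> Lp_class p M f \<in> vscale (Lp p M) t ` Lp_interval p M (Lp_class p M u) \<longleftrightarrow> t > 0 \<and> s \<le> t" for t
    using scaled_interval_iff[OF u f] abs_le_mult_iff_quotient[OF pos, of f t]
      Lp_fun_infinity_norm_le_iff[OF q, of t] unfolding s_def by auto
  then have "Lp_gauge p M (Lp_class p M u) (Lp_class p M f) = Inf {t. t > 0 \<and> s \<le> t}"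
    unfolding Lp_gauge_def by simp
  also have "\<dots> = s"
  \<comment> \<open>Because \<open>t > 0\<close> is strict, the infimum is not attained when
    \<open>s = 0\<close>; otherwise the competing numbers form a closed half-line.\<close>
  proof (cases "s = 0")
    case True
    then have "{t. t > 0 \<and> s \<le> t} = {0<..}"
      by auto
    then show ?thesis
      using True by simp
  next
    case False
    then have "{t. t > 0 \<and> s \<le> t} = {s..}"
      using s by auto
    then show ?thesis
      by simp
  qed
  finally show ?thesis
    unfolding s_def .
qed

text \<open>Division by \<open>u\<close> is linear, multiplication by \<open>u\<close> inverts it on
  classes, and the gauge formula says that it preserves norms.\<close>

theorem Lp_generating_isometric:
  assumes p: "1 \<le> p" and u: "u \<in> Lp_fun p M" and pos: "AE x in M. 0 < u x"
  shows "linearly_isometric (Lp_generating p M (Lp_class p M u)) (Lp \<infinity> M)"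
proof -
  note [measurable] = Lp_fun_measurable[OF u]
  let ?X = "Lp_generating p M (Lp_class p M u)"
  \<comment> \<open>\<open>D\<close> collects the functions whose classes make up the generating
    space, so that the work can be done on functions.\<close>
  define D where "D = {f \<in> Lp_fun p M. \<exists>t>0. AE x in M. \<bar>f x\<bar> \<le> t * u x}"
  define T where "T A = Lp_class \<infinity> M (\<lambda>x. (SOME f. f \<in> A) x / u x)" for A
  have "AE x in M. 0 \<le> u x"
    using pos by eventually_elim simp
  from generating_carrier_iff[OF p u this]
  have X: "vcarrier ?X = Lp_class p M ` D"
    unfolding D_def by (simp add: Lp_generating_def) blast
  have D: "f \<in> Lp_fun p M" if "f \<in> D" for f
    using that by (simp add: D_def)
  have q: "(\<lambda>x. f x / u x) \<in> Lp_fun \<infinity> M" if f: "f \<in> D" for f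
  proof -
    have [measurable]: "f \<in> borel_measurable M"
      using D[OF f] by (rule Lp_fun_measurable)
    obtain t where "AE x in M. \<bar>f x\<bar> \<le> t * u x"
      using f unfolding D_def by blast
    then show ?thesis
      using abs_le_mult_iff_quotient[OF pos, of f t] by (intro Lp_fun_infinity_bounded[of _ _ t]) auto
  qed
  have T: "T (Lp_class p M f) = Lp_class \<infinity> M (\<lambda>x. f x / u x)" if f: "f \<in> D" for f
  proof -
    define g where "g = (SOME g. g \<in> Lp_class p M f)"
    have g: "g \<in> Lp_fun p M" "AE x in M. f x = g x"
      unfolding g_def by (rule some_Lp_class[OF D[OF f]])+
    obtain t where t: "t > 0" "AE x in M. \<bar>f x\<bar> \<le> t * u x"
      using f unfolding D_def by blast
    \<comment> \<open>\<open>D\<close> is closed under a.e. equality, so the quotient of the chosen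
      representative is again a member of \<open>Lp_fun \<infinity> M\<close>.\<close>
    have "AE x in M. \<bar>g x\<bar> \<le> t * u x"
      using g(2) t(2) by eventually_elim simp
    with g(1) t(1) have gD: "g \<in> D"
      by (auto simp: D_def)
    have "AE x in M. g x / u x = f x / u x"
      using g(2) by eventually_elim simp
    then show ?thesis
      unfolding T_def g_def[symmetric] by (rule Lp_class_eq[OF q[OF gD] q[OF f]])
  qed
  have add: "(\<lambda>x. f x + g x) \<in> D" if f: "f \<in> D" and g: "g \<in> D" for f g
  proof -
    obtain s t where st: "s > 0" "t > 0" "AE x in M. \<bar>f x\<bar> \<le> s * u x" "AE x in M. \<bar>g x\<bar> \<le> t * u x"
      using f g unfolding D_def by blast
    from st(3,4) have "AE x in M. \<bar>f x + g x\<bar> \<le> (s + t) * u x"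
      by eventually_elim (unfold distrib_right, linarith)
    moreover have "s + t > 0"
      using st(1,2) by simp
    ultimately show ?thesis
      using Lp_fun_add[OF p D[OF f] D[OF g]] unfolding D_def by blast
  qed
  have scale: "(\<lambda>x. c * f x) \<in> D" if f: "f \<in> D" for c f
  proof -
    obtain t where t: "t > 0" "AE x in M. \<bar>f x\<bar> \<le> t * u x"
      using f unfolding D_def by blast
    \<comment> \<open>The summand 1 keeps the constant positive when \<open>c = 0\<close>, as
      \<open>D\<close> demands.\<close>
    have "AE x in M. \<bar>c * f x\<bar> \<le> ((\<bar>c\<bar> + 1) * t) * u x"
      using t(2)
    proof eventually_elim
      case (elim x)
      have "\<bar>c\<bar> * \<bar>f x\<bar> \<le> (\<bar>c\<bar> + 1) * (t * u x)"
        using elim by (intro mult_mono) auto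
      then show ?case
        by (simp add: abs_mult mult.assoc)
    qed
    moreover have "(\<bar>c\<bar> + 1) * t > 0"
      using t(1) by simp
    ultimately show ?thesis
      using Lp_fun_scale[OF D[OF f]] unfolding D_def by blast
  qed
  have "linear_on ?X T (Lp \<infinity> M)"
    unfolding linear_on_def X
  proof (intro conjI ballI allI; (elim imageE; hypsubst)?)
    fix f assume f: "f \<in> D"
    show "T (Lp_class p M f) \<in> vcarrier (Lp \<infinity> M)"
      using q[OF f] unfolding T[OF f] Lp_carrier_iff by blast
    show "T (vscale ?X c (Lp_class p M f)) = vscale (Lp \<infinity> M) c (T (Lp_class p M f))" for c
    proof -
      have "vscale ?X c (Lp_class p M f) = Lp_class p M (\<lambda>x. c * f x)"
        using vscale_Lp[OF D[OF f]] by (simp add: Lp_generating_def)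
      then show ?thesis
        using T[OF scale[OF f, of c]] T[OF f] vscale_Lp[OF q[OF f], of c] by simp
    qed
    fix g assume g: "g \<in> D"
    have "vadd ?X (Lp_class p M f) (Lp_class p M g) = Lp_class p M (\<lambda>x. f x + g x)"
      using vadd_Lp[OF p D[OF f] D[OF g]] by (simp add: Lp_generating_def)
    then show "T (vadd ?X (Lp_class p M f) (Lp_class p M g)) =
        vadd (Lp \<infinity> M) (T (Lp_class p M f)) (T (Lp_class p M g))"
      using T[OF add[OF f g]] T[OF f] T[OF g] vadd_Lp[OF _ q[OF f] q[OF g]]
      by (simp add: add_divide_distrib)
  qed
  moreover have "bij_betw T (vcarrier ?X) (vcarrier (Lp \<infinity> M))"
  proof (rule bij_betw_imageI)
    show "inj_on T (vcarrier ?X)"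
      unfolding X
    proof (intro inj_onI; elim imageE; hypsubst)
      fix f g assume f: "f \<in> D" and g: "g \<in> D" and "T (Lp_class p M f) = T (Lp_class p M g)"
      then have "AE x in M. f x / u x = g x / u x"
        using Lp_class_eq_iff[OF q[OF f] q[OF g]] T by simp
      then have "AE x in M. f x = g x"
        using pos by eventually_elim auto
      then show "Lp_class p M f = Lp_class p M g"
        using Lp_class_eq_iff[OF D[OF f] D[OF g]] by blast
    qed
    \<comment> \<open>Surjectivity: the preimage of the class of \<open>g\<close> is the class of
      \<open>g * u\<close>.\<close>
    have "\<exists>f\<in>D. h = T (Lp_class p M f)" if h: "h \<in> vcarrier (Lp \<infinity> M)" for h
    proof -
      obtain g where g: "g \<in> Lp_fun \<infinity> M" "h = Lp_class \<infinity> M g"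
        using h unfolding Lp_carrier_iff by blast
      note [measurable] = Lp_fun_measurable[OF g(1)]
      \<comment> \<open>Adding 1 makes the bound positive even if \<open>g\<close> vanishes
        a.e.\<close>
      define t where "t = Lp_fun_norm \<infinity> M g + 1"
      have t: "t > 0"
        unfolding t_def using Lp_fun_norm_nonneg[of \<infinity> M g] by linarith
      then have "AE x in M. \<bar>g x\<bar> \<le> t"
        using Lp_fun_infinity_norm_le_iff[OF g(1), of t] by (simp add: t_def)
      then have bound: "AE x in M. \<bar>g x * u x\<bar> \<le> t * u x"
        using pos by eventually_elim (auto simp: abs_mult intro: mult_right_mono)
      have "AE x in M. \<bar>g x * u x\<bar> \<le> \<bar>t * u x\<bar>"
        using bound by eventually_elim linarith
      then have "(\<lambda>x. g x * u x) \<in> Lp_fun p M"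
        by (intro Lp_fun_dominated[OF Lp_fun_scale[OF u, of t]]) measurable
      with bound t have d: "(\<lambda>x. g x * u x) \<in> D"
        unfolding D_def by blast
      have "AE x in M. g x = g x * u x / u x"
        using pos by eventually_elim simp
      then have "h = T (Lp_class p M (\<lambda>x. g x * u x))"
        unfolding T[OF d] g(2) using Lp_class_eq_iff[OF g(1) q[OF d]] by blast
      with d show ?thesis
        by blast
    qed
    moreover have "T (Lp_class p M f) \<in> vcarrier (Lp \<infinity> M)" if f: "f \<in> D" for f
      using q[OF f] unfolding T[OF f] Lp_carrier_iff by blast
    ultimately show "T ` vcarrier ?X = vcarrier (Lp \<infinity> M)"
      unfolding X image_image by blast
  qed
  moreover have "vnorm (Lp \<infinity> M) (T A) = vnorm ?X A" if A: "A \<in> vcarrier ?X" for A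
  proof -
    obtain f where f: "f \<in> D" "A = Lp_class p M f"
      using A X by blast
    show ?thesis
      unfolding f(2) T[OF f(1)] vnorm_Lp[OF q[OF f(1)]]
      using Lp_gauge_eq[OF u pos D[OF f(1)] q[OF f(1)]] by (simp add: Lp_generating_def)
  qed
  ultimately show ?thesis
    unfolding linearly_isometric_def by blast
qed

section \<open>Nonsupport points are positive almost everywhere\<close>

text \<open>Integration over a set \<open>B\<close> of finite measure is bounded on the space, with
  one constant for all \<open>f\<close>. With \<open>m\<close> the measure of \<open>B\<close>, the
  constant is \<open>m + 1\<close>: the bound \<open>m\<close> already works for essentially bounded
  functions, and the extra 1 comes from the power term for finite \<open>p\<close>.\<close>

lemma Lp_integrable_on_finite_set:
  assumes p: "1 \<le> p" and B: "B \<in> sets M" "emeasure M B < \<infinity>"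
  obtains K where "\<And>f. f \<in> Lp_fun p M \<Longrightarrow>
    integrable M (\<lambda>x. indicator B x * f x) \<and> (\<integral>x. \<bar>indicator B x * f x\<bar> \<partial>M) \<le> K * Lp_fun_norm p M f"
proof -
  define m where "m = measure M B"
  have m: "emeasure M B = ennreal m" "m \<ge> 0"
    using B by (auto simp: m_def emeasure_eq_ennreal_measure)
  have "(\<integral>\<^sup>+x. ennreal \<bar>indicator B x * f x\<bar> \<partial>M) \<le> ennreal ((m + 1) * Lp_fun_norm p M f)"
    if f: "f \<in> Lp_fun p M" for f
  proof -
    note [measurable] = Lp_fun_measurable[OF f] B(1)
    define N where "N = Lp_fun_norm p M f"
    have N: "0 \<le> N"
      unfolding N_def by (rule Lp_fun_norm_nonneg)
    show ?thesis
    proof (cases "p = \<infinity>")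
      case True
      have "AE x in M. \<bar>f x\<bar> \<le> N"
        using Lp_fun_infinity_norm_le_iff[of f M N] f N True by (simp add: N_def)
      then have "(\<integral>\<^sup>+x. ennreal \<bar>indicator B x * f x\<bar> \<partial>M) \<le> (\<integral>\<^sup>+x. ennreal N * indicator B x \<partial>M)"
        by (intro nn_integral_mono_AE) (auto elim!: eventually_mono simp: indicator_def intro: ennreal_leI)
      also have "\<dots> = ennreal (N * m)"
        using N m by (simp add: nn_integral_cmult ennreal_mult)
      also have "\<dots> \<le> ennreal ((m + 1) * N)"
        using N by (intro ennreal_leI) (simp add: algebra_simps)
      finally show ?thesis
        unfolding N_def .
    next
      case False
      define r where "r = enn2real p"
      have r: "r \<ge> 1"
        using p False by (cases p) (auto simp: r_def simp flip: ennreal_1)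
      define I where "I = (\<integral>\<^sup>+x. ennreal (\<bar>f x\<bar> powr r) \<partial>M)"
      have I: "I < \<infinity>"
        using f False by (simp add: Lp_fun_def I_def r_def)
      have NI: "N = enn2real I powr (1 / r)"
        using False by (simp add: N_def Lp_fun_norm_def I_def r_def)
      show ?thesis
      \<comment> \<open>The general argument divides by \<open>N\<close>; if \<open>N = 0\<close>
        then \<open>f\<close> vanishes a.e. and the integral is 0.\<close>
      proof (cases "N = 0")
        case True
        then have "I = 0"
          using I r NI by (cases I) auto
        then have "AE x in M. f x = 0"
          unfolding I_def by (subst (asm) nn_integral_0_iff_AE) (auto elim!: eventually_mono simp: ennreal_eq_0_iff)
        then have "(\<integral>\<^sup>+x. ennreal \<bar>indicator B x * f x\<bar> \<partial>M) = (\<integral>\<^sup>+x. 0 \<partial>M)"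
          by (intro nn_integral_cong_AE) (auto elim!: eventually_mono)
        then show ?thesis
          by simp
      next
        case False
        then have N0: "N > 0"
          using N by simp
        have NrI: "ennreal (N powr r) = I"
          using I r by (cases I) (auto simp: NI powr_powr)
        \<comment> \<open>With this factor, \<open>N * (\<bar>f x\<bar> / N) powr r\<close> equals
          \<open>a * \<bar>f x\<bar> powr r\<close>, whose integral is \<open>N\<close>.\<close>
        define a where "a = N / N powr r"
        have a: "a \<ge> 0" "a * N powr r = N"
          using N0 by (auto simp: a_def)
        \<comment> \<open>Homogeneity replaces Hoelder's inequality: \<open>y \<le> 1 + y powr r\<close> at \<open>y = \<bar>f x\<bar> / N\<close>.\<close>
        have "ennreal \<bar>indicator B x * f x\<bar> \<le>
            ennreal N * indicator B x + ennreal a * ennreal (\<bar>f x\<bar> powr r)" for x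
        proof -
          have *: "y \<le> 1 + y powr r" if "y \<ge> 0" for y :: real
          proof (cases "y \<le> 1")
            case True
            then show ?thesis
              by (simp add: add_increasing2)
          next
            case False
            then have "y powr 1 \<le> y powr r"
              using r by (intro powr_mono) auto
            then show ?thesis
              using False by simp
          qed
          have "\<bar>f x\<bar> = N * (\<bar>f x\<bar> / N)"
            using N0 by simp
          also have "\<dots> \<le> N * (1 + (\<bar>f x\<bar> / N) powr r)"
            using N0 by (intro mult_left_mono *) auto
          also have "\<dots> = N + a * \<bar>f x\<bar> powr r"
            using N0 by (simp add: a_def powr_divide algebra_simps)
          finally have "ennreal \<bar>f x\<bar> \<le> ennreal (N + a * \<bar>f x\<bar> powr r)"
            by (rule ennreal_leI)
          then have "ennreal \<bar>f x\<bar> \<le> ennreal N + ennreal a * ennreal (\<bar>f x\<bar> powr r)"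
            using N0 a(1) by (simp add: ennreal_mult)
          then show ?thesis
            by (simp add: indicator_def)
        qed
        then have "(\<integral>\<^sup>+x. ennreal \<bar>indicator B x * f x\<bar> \<partial>M) \<le>
            (\<integral>\<^sup>+x. ennreal N * indicator B x + ennreal a * ennreal (\<bar>f x\<bar> powr r) \<partial>M)"
          by (intro nn_integral_mono)
        also have "\<dots> = ennreal N * ennreal m + ennreal a * ennreal (N powr r)"
          unfolding NrI I_def m(1)[symmetric] by (simp add: nn_integral_add nn_integral_cmult)
        also have "\<dots> = ennreal ((m + 1) * N)"
          using N0 m(2) a by (simp add: algebra_simps flip: ennreal_mult ennreal_plus)
        finally show ?thesis
          unfolding N_def .
      qed
    qed
  qed
  then have "integrable M (\<lambda>x. indicator B x * f x) \<and>
      (\<integral>x. \<bar>indicator B x * f x\<bar> \<partial>M) \<le> (m + 1) * Lp_fun_norm p M f"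
    if f: "f \<in> Lp_fun p M" for f
  proof -
    note [measurable] = Lp_fun_measurable[OF f] B(1)
    have le: "(\<integral>\<^sup>+x. ennreal \<bar>indicator B x * f x\<bar> \<partial>M) \<le> ennreal ((m + 1) * Lp_fun_norm p M f)"
      using f by fact
    then have "(\<integral>\<^sup>+x. ennreal (norm (indicator B x * f x)) \<partial>M) < \<infinity>"
      unfolding real_norm_def by (rule le_less_trans) simp
    moreover have "(\<lambda>x. indicator B x * f x) \<in> borel_measurable M"
      by measurable
    ultimately have int: "integrable M (\<lambda>x. indicator B x * f x)"
      by (simp add: integrable_iff_bounded)
    then have "ennreal (\<integral>x. \<bar>indicator B x * f x\<bar> \<partial>M) \<le> ennreal ((m + 1) * Lp_fun_norm p M f)"
      using le by (subst nn_integral_eq_integral[symmetric]) auto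
    then have "(\<integral>x. \<bar>indicator B x * f x\<bar> \<partial>M) \<le> (m + 1) * Lp_fun_norm p M f"
      using m(2) Lp_fun_norm_nonneg[of p M f] by (simp add: ennreal_le_iff)
    with int show ?thesis
      by blast
  qed
  then show thesis
    using that by blast
qed

text \<open>Sigma-finiteness supplies a piece of finite positive measure inside the zero set of
  \<open>u\<close>: finite so that integration over it is a bounded functional, positive so that
  this functional is nonzero.\<close>

lemma nonsupport_point_pos:
  assumes "sigma_finite_measure M" and p: "1 \<le> p" and u: "u \<in> Lp_fun p M"
    and ns: "Lp_class p M u \<in> nonsupport_points (Lp p M) (Lp_cone p M)"
  shows "AE x in M. 0 < u x"
proof (rule ccontr)
  interpret sigma_finite_measure M by fact
  note [measurable] = Lp_fun_measurable[OF u]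
  have cone: "Lp_class p M u \<in> Lp_cone p M" and nsp: "\<not> support_point (Lp p M) (Lp_cone p M) (Lp_class p M u)"
    using ns by (auto simp: nonsupport_points_def)
  have u0: "AE x in M. 0 \<le> u x"
    using cone u by (simp add: Lp_cone_class_iff)
  \<comment> \<open>Since \<open>u\<close> is nonnegative a.e., it vanishes at almost every point of
    \<open>Z\<close>.\<close>
  define Z where "Z = {x \<in> space M. \<not> 0 < u x}"
  have [measurable]: "Z \<in> sets M"
    unfolding Z_def by measurable
  assume "\<not> (AE x in M. 0 < u x)"
  then have "emeasure M Z > 0"
    unfolding Z_def by (subst (asm) AE_iff_measurable[OF _ refl]) (auto simp: zero_less_iff_neq_zero)
  then obtain B where B: "B \<in> sets M" "B \<subseteq> Z" "0 < emeasure M B" "emeasure M B < \<infinity>"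
  proof -
    obtain A :: "nat \<Rightarrow> 'a set" where A: "range A \<subseteq> sets M" "(\<Union>i. A i) = space M" "\<And>i. emeasure M (A i) \<noteq> \<infinity>"
      using sigma_finite by metis
    have [measurable]: "A i \<in> sets M" for i
      using A(1) by auto
    \<comment> \<open>Countably many sets of finite measure cover the space, so if every
      \<open>Z \<inter> A i\<close> were null, \<open>Z\<close> would be null too.\<close>
    have "\<exists>i. emeasure M (Z \<inter> A i) \<noteq> 0"
    proof (rule ccontr)
      assume "\<nexists>i. emeasure M (Z \<inter> A i) \<noteq> 0"
      then have "emeasure M (\<Union>i. Z \<inter> A i) = 0"
        by (intro emeasure_UN_eq_0) auto
      moreover have "(\<Union>i. Z \<inter> A i) = Z"
        using A(2) by (auto simp: Z_def)
      ultimately show False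
        using \<open>emeasure M Z > 0\<close> by simp
    qed
    then obtain i where i: "emeasure M (Z \<inter> A i) \<noteq> 0"
      by blast
    have "emeasure M (Z \<inter> A i) \<le> emeasure M (A i)"
      by (intro emeasure_mono) auto
    also have "\<dots> < \<infinity>"
      using A(3)[of i] by (simp add: less_top)
    finally show thesis
      using that[of "Z \<inter> A i"] i by (auto simp: zero_less_iff_neq_zero)
  qed
  note [measurable] = B(1)
  obtain K where K: "\<And>f. f \<in> Lp_fun p M \<Longrightarrow> integrable M (\<lambda>x. indicator B x * f x) \<and>
      (\<integral>x. \<bar>indicator B x * f x\<bar> \<partial>M) \<le> K * Lp_fun_norm p M f"
    using Lp_integrable_on_finite_set[OF p B(1,4)] by metis
  \<comment> \<open>The minus sign makes the functional nonpositive on the cone, so its value 0 at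
    \<open>u\<close> is a maximum.\<close>
  define \<phi> where "\<phi> A = - (\<integral>x. indicator B x * (SOME f. f \<in> A) x \<partial>M)" for A :: "('a \<Rightarrow> real) set"
  have \<phi>: "\<phi> (Lp_class p M f) = - (\<integral>x. indicator B x * f x \<partial>M)" if f: "f \<in> Lp_fun p M" for f
  proof -
    define g where "g = (SOME g. g \<in> Lp_class p M f)"
    have "g \<in> Lp_fun p M" "AE x in M. f x = g x"
      unfolding g_def by (rule some_Lp_class[OF f])+
    then show ?thesis
      using Lp_fun_measurable[OF f] Lp_fun_measurable[of g p M] unfolding \<phi>_def g_def[symmetric]
      by (auto intro!: integral_cong_AE elim!: eventually_mono)
  qed
  have "\<phi> \<in> dual (Lp p M)"
    unfolding dual_def mem_Collect_eq linear_on_def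
  proof (intro conjI ballI allI exI[of _ K])
    fix A assume "A \<in> vcarrier (Lp p M)"
    then obtain f where f: "f \<in> Lp_fun p M" "A = Lp_class p M f"
      unfolding Lp_carrier_iff by blast
    show "\<phi> A \<in> vcarrier real_nspace"
      by (simp add: real_nspace_def)
    have "\<bar>\<phi> A\<bar> \<le> (\<integral>x. \<bar>indicator B x * f x\<bar> \<partial>M)"
      using integral_abs_bound[of M "\<lambda>x. indicator B x * f x"] by (simp only: f(2) \<phi>[OF f(1)] abs_minus_cancel)
    then show "\<bar>\<phi> A\<bar> \<le> K * vnorm (Lp p M) A"
      using K[OF f(1)] unfolding f(2) vnorm_Lp[OF f(1)] by linarith
    show "\<phi> (vscale (Lp p M) c A) = vscale real_nspace c (\<phi> A)" for c
      unfolding f(2) vscale_Lp[OF f(1)] \<phi>[OF f(1)] \<phi>[OF Lp_fun_scale[OF f(1)]]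
      by (simp add: real_nspace_def mult.left_commute[of _ c])
    fix A' assume "A' \<in> vcarrier (Lp p M)"
    then obtain g where g: "g \<in> Lp_fun p M" "A' = Lp_class p M g"
      unfolding Lp_carrier_iff by blast
    show "\<phi> (vadd (Lp p M) A A') = vadd real_nspace (\<phi> A) (\<phi> A')"
      unfolding f(2) g(2) vadd_Lp[OF p f(1) g(1)] \<phi>[OF f(1)] \<phi>[OF g(1)] \<phi>[OF Lp_fun_add[OF p f(1) g(1)]]
      using K[OF f(1)] K[OF g(1)] by (simp add: real_nspace_def distrib_left)
  qed
  moreover have "\<exists>z\<in>vcarrier (Lp p M). \<phi> z \<noteq> 0"
  proof
    have ind: "(indicator B :: 'a \<Rightarrow> real) \<in> Lp_fun p M"
      using Lp_fun_indicator[OF B(1,4)] .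
    then show "Lp_class p M (indicator B) \<in> vcarrier (Lp p M)"
      unfolding Lp_carrier_iff by blast
    \<comment> \<open>The product of the two indicators is the indicator of \<open>B\<close>, whose
      integral is the measure of \<open>B\<close>.\<close>
    have "\<phi> (Lp_class p M (indicator B)) = - measure M B"
      unfolding \<phi>[OF ind] using B by (simp flip: indicator_inter_arith)
    then show "\<phi> (Lp_class p M (indicator B)) \<noteq> 0"
      using B(3,4) by (auto simp: measure_def enn2real_eq_0_iff)
  qed
  moreover have "\<phi> A \<le> \<phi> (Lp_class p M u)" if A: "A \<in> Lp_cone p M" for A
  proof -
    obtain f where f: "f \<in> Lp_fun p M" "AE x in M. 0 \<le> f x" "A = Lp_class p M f"
      using Lp_cone_cases[OF A] .
    have "0 \<le> (\<integral>x. indicator B x * f x \<partial>M)"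
      using f(2) by (intro integral_nonneg_AE) (auto elim!: eventually_mono)
    moreover have "AE x in M. indicator B x * u x = 0"
      using u0
    proof eventually_elim
      case (elim x)
      then show ?case
        using B(2) by (auto simp: indicator_def Z_def)
    qed
    then have "(\<integral>x. indicator B x * u x \<partial>M) = 0"
      by (rule integral_eq_zero_AE)
    ultimately show ?thesis
      unfolding f(3) \<phi>[OF f(1)] \<phi>[OF u] by simp
  qed
  ultimately have "support_point (Lp p M) (Lp_cone p M) (Lp_class p M u)"
    unfolding support_point_def using cone by blast
  with nsp show False
    by simp
qed

section \<open>Existence of a nonsupport point\<close>

text \<open>Reduces the claim to norm convergence of the truncations \<open>min f (n u)\<close> for
  nonnegative \<open>f\<close>. The signs are required everywhere, not just a.e.; this costs
  nothing, as an arbitrary function is later split into its positive and negative parts.\<close>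

lemma nonsupport_pointI:
  assumes p: "1 \<le> p" and u: "u \<in> Lp_fun p M" and u0: "\<And>x. 0 \<le> u x"
    and lim: "\<And>f. f \<in> Lp_fun p M \<Longrightarrow> (\<And>x. 0 \<le> f x) \<Longrightarrow>
      (\<lambda>n. Lp_fun_norm p M (\<lambda>x. f x - min (f x) (real n * u x))) \<longlonglongrightarrow> 0"
  shows "Lp_class p M u \<in> nonsupport_points (Lp p M) (Lp_cone p M)"
proof -
  note [measurable] = Lp_fun_measurable[OF u]
  have cone: "Lp_class p M u \<in> Lp_cone p M"
    using u u0 by (simp add: Lp_cone_class_iff)
  have "\<phi> z = 0" if \<phi>: "\<phi> \<in> dual (Lp p M)" and max: "\<forall>y\<in>Lp_cone p M. \<phi> y \<le> \<phi> (Lp_class p M u)"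
    and z: "z \<in> vcarrier (Lp p M)" for \<phi> z
  proof -
    define \<psi> where "\<psi> f = \<phi> (Lp_class p M f)" for f
    obtain K where K: "\<And>A. A \<in> vcarrier (Lp p M) \<Longrightarrow> \<bar>\<phi> A\<bar> \<le> K * vnorm (Lp p M) A"
      and lin: "linear_on (Lp p M) \<phi> real_nspace"
      using \<phi> by (auto simp: dual_def)
    have car: "Lp_class p M f \<in> vcarrier (Lp p M)" if "f \<in> Lp_fun p M" for f
      using that unfolding Lp_carrier_iff by blast
    have add: "\<psi> (\<lambda>x. f x + g x) = \<psi> f + \<psi> g" if "f \<in> Lp_fun p M" "g \<in> Lp_fun p M" for f g
    proof -
      have "\<phi> (vadd (Lp p M) (Lp_class p M f) (Lp_class p M g)) = \<psi> f + \<psi> g"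
        using lin car[OF that(1)] car[OF that(2)] by (simp add: \<psi>_def linear_on_def real_nspace_def)
      then show ?thesis
        unfolding vadd_Lp[OF p that] by (simp add: \<psi>_def)
    qed
    have scale: "\<psi> (\<lambda>x. c * f x) = c * \<psi> f" if "f \<in> Lp_fun p M" for f c
    proof -
      have "\<phi> (vscale (Lp p M) c (Lp_class p M f)) = c * \<psi> f"
        using lin car[OF that] by (simp add: \<psi>_def linear_on_def real_nspace_def)
      then show ?thesis
        unfolding vscale_Lp[OF that] by (simp add: \<psi>_def)
    qed
    have bound: "\<bar>\<psi> f\<bar> \<le> K * Lp_fun_norm p M f" if "f \<in> Lp_fun p M" for f
      using K[OF car[OF that]] unfolding vnorm_Lp[OF that] \<psi>_def .
    have Lp_diff: "(\<lambda>x. f x - g x) \<in> Lp_fun p M" if "f \<in> Lp_fun p M" "g \<in> Lp_fun p M" for f g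
      using Lp_fun_add[OF p that(1) Lp_fun_scale[OF that(2), of "-1"]] by simp
    have diff: "\<psi> (\<lambda>x. f x - g x) = \<psi> f - \<psi> g" if "f \<in> Lp_fun p M" "g \<in> Lp_fun p M" for f g
      using add[OF that(1) Lp_fun_scale[OF that(2), of "-1"]] scale[OF that(2), of "-1"] by simp
    have le: "\<psi> f \<le> \<psi> u" if "f \<in> Lp_fun p M" "\<And>x. 0 \<le> f x" for f
      using max that unfolding \<psi>_def by (simp add: Lp_cone_class_iff)
    \<comment> \<open>The cone contains all nonnegative multiples of \<open>u\<close>:
      \<open>c = 0\<close> gives \<open>0 \<le> \<psi> u\<close>, and \<open>c = 2\<close> gives
      \<open>\<psi> u \<le> 0\<close>.\<close>
    have "c * \<psi> u \<le> \<psi> u" if "0 \<le> c" for c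
      unfolding scale[OF u, symmetric] using u0 that by (intro le Lp_fun_scale u) auto
    from this[of 0] this[of 2] have \<psi>u: "\<psi> u = 0"
      by simp
    have nonpos: "\<psi> f \<le> 0" if "f \<in> Lp_fun p M" "\<And>x. 0 \<le> f x" for f
      using le[OF that] \<psi>u by simp
    have zero: "\<psi> f = 0" if f: "f \<in> Lp_fun p M" and f0: "\<And>x. 0 \<le> f x" for f
    proof -
      note [measurable] = Lp_fun_measurable[OF f]
      define g where "g n x = min (f x) (real n * u x)" for n x
      have g: "g n \<in> Lp_fun p M" for n
        unfolding g_def using f0 u0 by (intro Lp_fun_dominated[OF f]) auto
      \<comment> \<open>Both \<open>g n\<close> and \<open>n u - g n\<close> are nonnegative, so
        \<open>\<psi>\<close> is nonpositive on each, while their sum \<open>n u\<close> has value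
        0.\<close>
      have "\<psi> (g n) = 0" for n
      proof (rule antisym)
        show "\<psi> (g n) \<le> 0"
          using f0 u0 by (intro nonpos g) (simp add: g_def)
        have "\<psi> (\<lambda>x. real n * u x - g n x) \<le> 0"
          by (intro nonpos Lp_diff Lp_fun_scale u g) (simp add: g_def)
        then show "0 \<le> \<psi> (g n)"
          unfolding diff[OF Lp_fun_scale[OF u] g] scale[OF u] \<psi>u by simp
      qed
      \<comment> \<open>As \<open>\<psi>\<close> vanishes on \<open>g n\<close>, it takes the same
        value at \<open>f\<close> and at the remainder \<open>f - g n\<close>.\<close>
      then have "\<bar>\<psi> f\<bar> \<le> K * Lp_fun_norm p M (\<lambda>x. f x - g n x)" for n
        using bound[OF Lp_diff[OF f g[of n]]] unfolding diff[OF f g[of n]] by simp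
      moreover have "(\<lambda>n. K * Lp_fun_norm p M (\<lambda>x. f x - g n x)) \<longlonglongrightarrow> K * 0"
        unfolding g_def by (intro tendsto_mult tendsto_const lim f f0)
      ultimately have "\<bar>\<psi> f\<bar> \<le> K * 0"
        by (intro tendsto_lowerbound[where F=sequentially]) auto
      then show ?thesis
        by simp
    qed
    obtain f where f: "f \<in> Lp_fun p M" "z = Lp_class p M f"
      using z unfolding Lp_carrier_iff by blast
    note [measurable] = Lp_fun_measurable[OF f(1)]
    have pm: "(\<lambda>x. max 0 (f x)) \<in> Lp_fun p M" "(\<lambda>x. max 0 (- f x)) \<in> Lp_fun p M"
      by (rule Lp_fun_dominated[OF f(1)]; auto)+
    have "(\<lambda>x. max 0 (f x) - max 0 (- f x)) = f"
      by (auto simp: max_def)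
    then have "\<psi> f = 0"
      using diff[OF pm] zero[OF pm(1)] zero[OF pm(2)] by simp
    then show ?thesis
      unfolding f(2) \<psi>_def .
  qed
  then show ?thesis
    using cone unfolding nonsupport_points_def support_point_def by blast
qed

theorem nonsupport_point_exists:
  assumes "sigma_finite_measure M" and p: "1 \<le> p"
  shows "nonsupport_points (Lp p M) (Lp_cone p M) \<noteq> {}"
proof (cases "p = \<infinity>")
  case True
  have one: "(\<lambda>x. 1) \<in> Lp_fun \<infinity> M"
    by (rule Lp_fun_infinity_bounded[where t=1]) auto
  have "Lp_class p M (\<lambda>x. 1) \<in> nonsupport_points (Lp p M) (Lp_cone p M)"
    unfolding True
  proof (rule nonsupport_pointI)
    fix f assume f: "f \<in> Lp_fun \<infinity> M" and f0: "\<And>x. 0 \<le> f x"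
    note [measurable] = Lp_fun_measurable[OF f]
    define N where "N = Lp_fun_norm \<infinity> M f"
    have "AE x in M. \<bar>f x\<bar> \<le> N"
      using Lp_fun_infinity_norm_le_iff[OF f, of N] Lp_fun_norm_nonneg[of \<infinity> M f] by (simp add: N_def)
    \<comment> \<open>Once \<open>n\<close> reaches the norm of \<open>f\<close>, truncating at
      \<open>n\<close> changes \<open>f\<close> only on a null set, so the sequence is eventually
      0.\<close>
    then have "Lp_fun_norm \<infinity> M (\<lambda>x. f x - min (f x) (real n * 1)) = 0" if "N \<le> real n" for n
    proof -
      have *: "AE x in M. \<bar>f x - min (f x) (real n * 1)\<bar> \<le> 0"
        using \<open>AE x in M. \<bar>f x\<bar> \<le> N\<close> by eventually_elim (use that in auto)
      then have "(\<lambda>x. f x - min (f x) (real n * 1)) \<in> Lp_fun \<infinity> M"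
        by (intro Lp_fun_infinity_bounded[where t=0]) auto
      then show ?thesis
        using Lp_fun_infinity_norm_le_iff[of _ M 0] * by (meson Lp_fun_norm_nonneg antisym order_refl)
    qed
    moreover have "eventually (\<lambda>n. N \<le> real n) sequentially"
      using eventually_ge_at_top[of "nat \<lceil>N\<rceil>"] by eventually_elim linarith
    ultimately show "(\<lambda>n. Lp_fun_norm \<infinity> M (\<lambda>x. f x - min (f x) (real n * 1))) \<longlonglongrightarrow> 0"
      by (intro tendsto_eventually) (auto elim!: eventually_mono)
  qed (use one in auto)
  then show ?thesis
    by blast
next
  case False
  interpret sigma_finite_measure M by fact
  define r where "r = enn2real p"
  have r: "r \<ge> 1"
    using p False by (cases p) (auto simp: r_def simp flip: ennreal_1)
  obtain h where h[measurable]: "h \<in> borel_measurable M" and hfin: "(\<integral>\<^sup>+x. h x \<partial>M) \<noteq> \<infinity>"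
    and hpos: "\<forall>x\<in>space M. 0 < h x \<and> h x < \<infinity>"
    using Ex_finite_integrable_function by blast
  \<comment> \<open>The \<open>r\<close>-th power of \<open>u\<close> recovers the strictly positive
    function \<open>h\<close> of finite integral given by sigma-finiteness. Outside the space
    \<open>u\<close> is still nonnegative, as the criterion asks.\<close>
  define u where "u x = enn2real (h x) powr (1 / r)" for x
  have [measurable]: "u \<in> borel_measurable M"
    unfolding u_def by measurable
  have "(\<integral>\<^sup>+x. ennreal (\<bar>u x\<bar> powr r) \<partial>M) = (\<integral>\<^sup>+x. h x \<partial>M)"
    using r hpos by (intro nn_integral_cong) (auto simp: u_def powr_powr ennreal_enn2real_if less_top)
  also have "\<dots> < \<infinity>"
    using hfin by (simp add: less_top)
  finally have u: "u \<in> Lp_fun p M"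
    using False by (simp add: Lp_fun_def r_def)
  have upos: "u x > 0" if "x \<in> space M" for x
    using hpos that by (auto simp: u_def enn2real_eq_0_iff)
  have "Lp_class p M u \<in> nonsupport_points (Lp p M) (Lp_cone p M)"
  proof (rule nonsupport_pointI[OF p u])
    fix f assume f: "f \<in> Lp_fun p M" and f0: "\<And>x. 0 \<le> f x"
    note [measurable] = Lp_fun_measurable[OF f]
    define g where "g n x = f x - min (f x) (real n * u x)" for n x
    have [measurable]: "g n \<in> borel_measurable M" for n
      unfolding g_def by measurable
    have g: "0 \<le> g n x" "g n x \<le> f x" for n x
      using f0[of x] by (auto simp: g_def u_def)
    define I where "I n = (\<integral>\<^sup>+x. ennreal (\<bar>g n x\<bar> powr r) \<partial>M)" for n
    have "I \<longlonglongrightarrow> (\<integral>\<^sup>+x. 0 \<partial>M)"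
      unfolding I_def
    proof (rule nn_integral_dominated_convergence[where w="\<lambda>x. ennreal (\<bar>f x\<bar> powr r)"])
      show "AE x in M. ennreal (\<bar>g n x\<bar> powr r) \<le> ennreal (\<bar>f x\<bar> powr r)" for n
        using g r f0 by (intro AE_I2 ennreal_leI powr_mono2) auto
      show "(\<integral>\<^sup>+x. ennreal (\<bar>f x\<bar> powr r) \<partial>M) < \<infinity>"
        using f False by (simp add: Lp_fun_def r_def)
      show "AE x in M. (\<lambda>n. ennreal (\<bar>g n x\<bar> powr r)) \<longlonglongrightarrow> 0"
      proof (rule AE_I2)
        fix x assume x: "x \<in> space M"
        \<comment> \<open>As \<open>u x > 0\<close>, the multiple \<open>n * u x\<close> exceeds
          \<open>f x\<close> from some \<open>n\<close> on, and the remainder is then exactly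
          0.\<close>
        have "eventually (\<lambda>n. g n x = 0) sequentially"
          using eventually_ge_at_top[of "nat \<lceil>f x / u x\<rceil>"]
        proof eventually_elim
          case (elim n)
          then have "f x / u x \<le> real n"
            by linarith
          then show ?case
            using upos[OF x] by (simp add: g_def field_simps)
        qed
        then show "(\<lambda>n. ennreal (\<bar>g n x\<bar> powr r)) \<longlonglongrightarrow> 0"
          by (intro tendsto_eventually) (auto elim!: eventually_mono)
      qed
    qed auto
    then have "I \<longlonglongrightarrow> ennreal 0"
      by simp
    then have "(\<lambda>n. enn2real (I n)) \<longlonglongrightarrow> 0"
      by (rule tendsto_enn2real) simp
    then have "(\<lambda>n. enn2real (I n) powr (1 / r)) \<longlonglongrightarrow> 0"
      using r by (intro tendsto_zero_powrI[where b="1/r"]) auto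
    then show "(\<lambda>n. Lp_fun_norm p M (\<lambda>x. f x - min (f x) (real n * u x))) \<longlonglongrightarrow> 0"
      using False by (simp add: Lp_fun_norm_def I_def g_def r_def)
  qed (simp add: u_def)
  then show ?thesis
    by blast
qed

theorem theorem8:
  fixes M :: "'a measure" and p :: ennreal
  assumes "sigma_finite_measure M" and "1 \<le> p"
  shows "nonsupport_points (Lp p M) (Lp_cone p M) \<noteq> {} \<and>
    (\<forall>u \<in> nonsupport_points (Lp p M) (Lp_cone p M).
       linearly_isometric (Lp_generating p M u) (Lp \<infinity> M))"
proof (intro conjI ballI)
  show "nonsupport_points (Lp p M) (Lp_cone p M) \<noteq> {}"
    using assms by (rule nonsupport_point_exists)
  fix U assume U: "U \<in> nonsupport_points (Lp p M) (Lp_cone p M)"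
  then have "U \<in> Lp_cone p M"
    by (simp add: nonsupport_points_def)
  then obtain u where u: "u \<in> Lp_fun p M" "U = Lp_class p M u"
    by (rule Lp_cone_cases)
  have "AE x in M. 0 < u x"
    using nonsupport_point_pos[OF assms u(1)] U u(2) by blast
  then show "linearly_isometric (Lp_generating p M U) (Lp \<infinity> M)"
    unfolding u(2) by (rule Lp_generating_isometric[OF assms(2) u(1)])
qed

end
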